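(* Let $G$ be a connected graph with root $r$, let $S\subseteq V(G)$ be a cut set of $G$, and let $G_0,G_1,\dots,G_k$ be the components of $G-S$ with $r\in V(G_0)$. If for every $v\in S$ we have $|N(v)-(V(G_0)\cup S)|\ge 2$, and for every $x\in N(S)-(V(G_0)\cup S)$ we have $|N(x)-S|\ge 2$, then $\eta(G,r)=\infty$.
   Context: All graphs are finite, simple and connected. $N(v)$ is the open neighborhood of $v$ and $N(S)=\bigcup_{v\in S}N(v)$. A configuration $C$ on $G$ is a function $C:V(G)\to\mathbb{Z}_{\ge 0}$; its size is $\sum_v C(v)$. A pebbling move removes two pebbles from a vertex and places one pebble on an adjacent vertex. The Two-Player Pebbling Game on $G$ with root $r$ and starting configuration $C$ is played by Mover and Defender in rounds: in each round Mover makes a pebbling move and then Defender makes a pebbling move; each player must take their turn. If Mover pebbles from $u$ to $v$, Defender may not pebble from $v$ to $u$ in the same round. Mover wins if at any time the root has at least one pebble; Defender wins if the root has no pebble and there are no more pebbling moves. A winning strategy is a rule choosing a player's moves as a function of the current position which guarantees that player wins. $\eta(G,r)$ is the minimum $m$ such that for every configuration of $m$ pebbles Mover has a winning strategy; if for arbitrarily large $m$ there is a configuration of size greater than $m$ on which Defender has a winning strategy, then $\eta(G,r)=\infty$. *)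

theory Defs
  imports "Graph_Theory.Digraph_Component" "HOL-Library.Extended_Nat"
begin

(* Finite simple graphs are the symmetric, loop-free digraphs without parallel arcs
   of the locale "graph"; each edge uv is present as the two arcs u -> v and v -> u. *)

definition nbhd :: "('a, 'b) pre_digraph \<Rightarrow> 'a \<Rightarrow> 'a set" where
  "nbhd G v = {w. v \<rightarrow>\<^bsub>G\<^esub> w}"

definition nbhd_set :: "('a, 'b) pre_digraph \<Rightarrow> 'a set \<Rightarrow> 'a set" where
  "nbhd_set G S = (\<Union>v\<in>S. nbhd G v)"

definition delete_verts :: "('a, 'b) pre_digraph \<Rightarrow> 'a set \<Rightarrow> ('a, 'b) pre_digraph" where
  "delete_verts G S = G \<restriction> (verts G - S)"

(* In a symmetric digraph the strongly connected components are the connected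
   components of the graph, as induced subgraphs. *)
definition components :: "('a, 'b) pre_digraph \<Rightarrow> ('a, 'b) pre_digraph set" where
  "components G = pre_digraph.sccs G"

(* The null graph does not count as connected in the library, so deleting all
   vertices has to be excluded explicitly. *)
definition cut_set :: "('a, 'b) pre_digraph \<Rightarrow> 'a set \<Rightarrow> bool" where
  "cut_set G S \<longleftrightarrow>
     S \<subseteq> verts G \<and> verts G - S \<noteq> {} \<and> \<not> connected (delete_verts G S)"

type_synonym 'a config = "'a \<Rightarrow> nat"

(* A configuration is a function on the vertices of G, extended by 0 to the whole type. *)
definition configuration :: "('a, 'b) pre_digraph \<Rightarrow> 'a config \<Rightarrow> bool" where
  "configuration G C \<longleftrightarrow> (\<forall>v. v \<notin> verts G \<longrightarrow> C v = 0)"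

definition config_size :: "('a, 'b) pre_digraph \<Rightarrow> 'a config \<Rightarrow> nat" where
  "config_size G C = (\<Sum>v\<in>verts G. C v)"

(* The pair (u, v) stands for the move that pebbles from u to v. *)
type_synonym 'a move = "'a \<times> 'a"

definition pebbling_moves :: "('a, 'b) pre_digraph \<Rightarrow> 'a config \<Rightarrow> 'a move set" where
  "pebbling_moves G C = {(u, v). u \<rightarrow>\<^bsub>G\<^esub> v \<and> 2 \<le> C u}"

fun apply_move :: "'a config \<Rightarrow> 'a move \<Rightarrow> 'a config" where
  "apply_move C (u, v) = C(u := C u - 2, v := C v + 1)"

datatype player = Mover | Defender

(* When it is Defender's turn, the position records the move that Mover has just made in
   the current round, since Defender is not allowed to reverse it. *)
datatype 'a position =
    Mover_Turn "'a config"
  | Defender_Turn "'a config" "'a move"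

fun config_of :: "'a position \<Rightarrow> 'a config" where
  "config_of (Mover_Turn C) = C"
| "config_of (Defender_Turn C m) = C"

fun to_move :: "'a position \<Rightarrow> player" where
  "to_move (Mover_Turn C) = Mover"
| "to_move (Defender_Turn C m) = Defender"

fun legal_moves :: "('a, 'b) pre_digraph \<Rightarrow> 'a position \<Rightarrow> 'a move set" where
  "legal_moves G (Mover_Turn C) = pebbling_moves G C"
| "legal_moves G (Defender_Turn C (u, v)) = pebbling_moves G C - {(v, u)}"

fun next_position :: "'a position \<Rightarrow> 'a move \<Rightarrow> 'a position" where
  "next_position (Mover_Turn C) m = Defender_Turn (apply_move C m) m"
| "next_position (Defender_Turn C m') m = Mover_Turn (apply_move C m)"

(* "No more pebbling moves" means that the player whose turn it is has no legal move.
   In particular, Defender also wins if the only remaining move is the reversal of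
   Mover's move in the current round. *)
fun wins_at :: "('a, 'b) pre_digraph \<Rightarrow> 'a \<Rightarrow> player \<Rightarrow> 'a position \<Rightarrow> bool" where
  "wins_at G r Mover p \<longleftrightarrow> 1 \<le> config_of p r"
| "wins_at G r Defender p \<longleftrightarrow> config_of p r = 0 \<and> legal_moves G p = {}"

definition game_over :: "('a, 'b) pre_digraph \<Rightarrow> 'a \<Rightarrow> 'a position \<Rightarrow> bool" where
  "game_over G r p \<longleftrightarrow> (\<exists>P. wins_at G r P p)"

definition is_play :: "('a, 'b) pre_digraph \<Rightarrow> 'a \<Rightarrow> 'a config \<Rightarrow> 'a position list \<Rightarrow> bool" where
  "is_play G r C ps \<longleftrightarrow>
     ps \<noteq> [] \<and> hd ps = Mover_Turn C \<and>
     (\<forall>i. Suc i < length ps \<longrightarrow>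
        \<not> game_over G r (ps ! i) \<and>
        (\<exists>m \<in> legal_moves G (ps ! i). ps ! Suc i = next_position (ps ! i) m))"

(* Every move lowers the number of pebbles by one, so all plays are finite and every play
   can be prolonged to a complete one. *)
definition complete_play :: "('a, 'b) pre_digraph \<Rightarrow> 'a \<Rightarrow> 'a config \<Rightarrow> 'a position list \<Rightarrow> bool" where
  "complete_play G r C ps \<longleftrightarrow> is_play G r C ps \<and> game_over G r (last ps)"

type_synonym 'a strategy = "'a position \<Rightarrow> 'a move"

definition is_strategy :: "('a, 'b) pre_digraph \<Rightarrow> 'a \<Rightarrow> player \<Rightarrow> 'a strategy \<Rightarrow> bool" where
  "is_strategy G r P \<sigma> \<longleftrightarrow>
     (\<forall>p. to_move p = P \<and> \<not> game_over G r p \<longrightarrow> \<sigma> p \<in> legal_moves G p)"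

definition follows :: "player \<Rightarrow> 'a strategy \<Rightarrow> 'a position list \<Rightarrow> bool" where
  "follows P \<sigma> ps \<longleftrightarrow>
     (\<forall>i. Suc i < length ps \<and> to_move (ps ! i) = P \<longrightarrow>
        ps ! Suc i = next_position (ps ! i) (\<sigma> (ps ! i)))"

definition winning_strategy ::
    "('a, 'b) pre_digraph \<Rightarrow> 'a \<Rightarrow> 'a config \<Rightarrow> player \<Rightarrow> 'a strategy \<Rightarrow> bool" where
  "winning_strategy G r C P \<sigma> \<longleftrightarrow>
     is_strategy G r P \<sigma> \<and>
     (\<forall>ps. complete_play G r C ps \<and> follows P \<sigma> ps \<longrightarrow> wins_at G r P (last ps))"

definition has_winning_strategy ::
    "('a, 'b) pre_digraph \<Rightarrow> 'a \<Rightarrow> 'a config \<Rightarrow> player \<Rightarrow> bool" where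
  "has_winning_strategy G r C P \<longleftrightarrow> (\<exists>\<sigma>. winning_strategy G r C P \<sigma>)"

definition eta :: "('a, 'b) pre_digraph \<Rightarrow> 'a \<Rightarrow> enat" where
  "eta G r =
     (if \<forall>m. \<exists>C. configuration G C \<and> config_size G C > m \<and> has_winning_strategy G r C Defender
      then \<infinity>
      else enat (LEAST m. \<forall>C. configuration G C \<and> config_size G C = m \<longrightarrow>
                   has_winning_strategy G r C Mover))"

end

theory Submission
  imports Defs
begin

text \<open>All pebbles start in \<open>B = V(G) - S - V(G\<^sub>0)\<close>, which has no edge to \<open>G\<^sub>0\<close>. Defender
  maintains that, whenever it is Mover's turn, \<open>G\<^sub>0\<close> is empty and every vertex of \<open>S\<close> carries at
  most one pebble. Then Mover can only pebble out of \<open>B\<close>. If this puts a second pebble on some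
  \<open>v \<in> S\<close>, Defender pebbles from \<open>v\<close> to a neighbor in \<open>B\<close> other than the vertex Mover used;
  otherwise every move available to Defender starts at some \<open>x \<in> B\<close>, and the second degree condition
  lets Defender pebble from \<open>x\<close> within \<open>B\<close> instead.\<close>

lemma ex_mem_neq_if_card_ge_2:
  assumes "2 \<le> card A"
  shows "\<exists>y\<in>A. y \<noteq> z"
proof (rule ccontr)
  assume "\<not> ?thesis"
  then have "A \<subseteq> {z}" by blast
  then have "card A \<le> 1" using card_mono[of "{z}" A] by simp
  with assms show False by simp
qed

text \<open>This reduces winning to an invariant at Mover's turns. Since Mover also wins in the
  middle of a round, \<open>root'\<close> checks the root after Mover's move; \<open>step\<close>
  asks for a reply only if one exists, because with an empty root a stuck Defender has won.\<close>

lemma defender_wins_if_invariant: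
  fixes I :: "'a config \<Rightarrow> bool"
  assumes init: "I C\<^sub>0"
    and root: "\<And>C. I C \<Longrightarrow> C r = 0"
    and root': "\<And>C m. I C \<Longrightarrow> m \<in> pebbling_moves G C \<Longrightarrow> apply_move C m r = 0"
    and step: "\<And>C m. I C \<Longrightarrow> m \<in> pebbling_moves G C \<Longrightarrow>
        legal_moves G (Defender_Turn (apply_move C m) m) \<noteq> {} \<Longrightarrow>
        \<exists>m' \<in> legal_moves G (Defender_Turn (apply_move C m) m).
          I (apply_move (apply_move C m) m')"
  shows "has_winning_strategy G r C\<^sub>0 Defender"
proof -
  define good where "good p m \<longleftrightarrow> m \<in> legal_moves G p \<and> I (apply_move (config_of p) m)" for p m
  \<comment> \<open>\<open>is_strategy\<close> demands a legal move at every unfinished position,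
    including those that no play within the invariant reaches; the second branch serves
    these.\<close>
  define \<sigma> where "\<sigma> p = (if Ex (good p) then SOME m. good p m else SOME m. m \<in> legal_moves G p)"
    for p
  \<comment> \<open>This extends \<open>I\<close> to Defender's turns, so that induction along a
    play can proceed one move at a time.\<close>
  define safe where "safe p \<longleftrightarrow> (case p of Mover_Turn C \<Rightarrow> I C
    | Defender_Turn C m \<Rightarrow> C r = 0 \<and> (legal_moves G p \<noteq> {} \<longrightarrow> Ex (good p)))" for p
  have good_\<sigma>: "good p (\<sigma> p)" if "Ex (good p)" for p
    using someI_ex[OF that] that by (simp add: \<sigma>_def)
  have strategy: "is_strategy G r Defender \<sigma>"
    unfolding is_strategy_def
  proof (intro allI impI)
    fix p
    assume p: "to_move p = Defender \<and> \<not> game_over G r p"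
    then have "\<not> wins_at G r Mover p" "\<not> wins_at G r Defender p"
      unfolding game_over_def by blast+
    then have "legal_moves G p \<noteq> {}" by simp
    then have "(SOME m. m \<in> legal_moves G p) \<in> legal_moves G p" by (simp add: some_in_eq)
    moreover have "\<sigma> p \<in> legal_moves G p" if "Ex (good p)"
      using good_\<sigma>[OF that] by (simp add: good_def)
    ultimately show "\<sigma> p \<in> legal_moves G p" by (cases "Ex (good p)") (auto simp: \<sigma>_def)
  qed
  have safe_root: "config_of p r = 0" if "safe p" for p
    using that root by (cases p) (auto simp: safe_def)
  have "wins_at G r Defender (last ps)"
    if "complete_play G r C\<^sub>0 ps" and \<sigma>: "follows Defender \<sigma> ps" for ps
  proof -
    from that have play: "is_play G r C\<^sub>0 ps" and over: "game_over G r (last ps)"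
      by (auto simp: complete_play_def)
    then have ne: "ps \<noteq> []" and hd: "hd ps = Mover_Turn C\<^sub>0" by (auto simp: is_play_def)
    have safe_nth: "safe (ps ! i)" if "i < length ps" for i
      using that
    proof (induction i)
      case 0
      then show ?case using hd ne init by (simp add: hd_conv_nth safe_def)
    next
      case (Suc i)
      then have IH: "safe (ps ! i)" by simp
      from play Suc.prems obtain m where m: "m \<in> legal_moves G (ps ! i)"
        and next_m: "ps ! Suc i = next_position (ps ! i) m"
        unfolding is_play_def by blast
      show ?case
      proof (cases "ps ! i")
        case (Mover_Turn C)
        with IH m have m: "I C" "m \<in> pebbling_moves G C" by (auto simp: safe_def)
        let ?q = "Defender_Turn (apply_move C m) m"
        have "legal_moves G ?q \<noteq> {} \<longrightarrow> Ex (good ?q)"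
          using step[OF m] unfolding good_def config_of.simps by blast
        then show ?thesis
          using root'[OF m] next_m Mover_Turn by (simp add: safe_def)
      next
        case (Defender_Turn C m')
        with IH m have "Ex (good (ps ! i))" by (auto simp: safe_def)
        then have "good (ps ! i) (\<sigma> (ps ! i))" by (rule good_\<sigma>)
        moreover have "ps ! Suc i = next_position (ps ! i) (\<sigma> (ps ! i))"
          using \<sigma> Suc.prems Defender_Turn by (simp add: follows_def)
        ultimately show ?thesis using Defender_Turn by (simp add: safe_def good_def)
      qed
    qed
    have "config_of (last ps) r = 0"
      using safe_root[OF safe_nth] ne by (simp add: last_conv_nth)
    moreover obtain P where "wins_at G r P (last ps)"
      using over unfolding game_over_def by blast
    ultimately show ?thesis by (cases P) auto
  qed
  with strategy show ?thesis
    unfolding has_winning_strategy_def winning_strategy_def by blast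
qed

text \<open>\<open>A\<close> stands for the vertices of the root component; the component structure
  enters only through \<open>sep\<close>.\<close>

lemma defender_wins_if_outside_root_side:
  fixes G :: "('a, 'b) pre_digraph"
  assumes "graph G"
    and r: "r \<in> A"
    and sep: "\<And>u v. u \<rightarrow>\<^bsub>G\<^esub> v \<Longrightarrow> u \<notin> A \<union> S \<Longrightarrow> v \<notin> A"
    and deg_S: "\<forall>v\<in>S. 2 \<le> card (nbhd G v - (A \<union> S))"
    and deg_out: "\<forall>x\<in>nbhd_set G S - (A \<union> S). 2 \<le> card (nbhd G x - S)"
    and init: "\<forall>v\<in>A \<union> S. C\<^sub>0 v = 0"
  shows "has_winning_strategy G r C\<^sub>0 Defender"
proof -
  interpret graph G by fact
  define I where "I C \<longleftrightarrow> (\<forall>v\<in>A. C v = 0) \<and> (\<forall>v\<in>S. C v \<le> 1)" for C :: "'a config"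
  have mover: "u \<notin> A \<union> S \<and> v \<notin> A" if "I C" "(u, v) \<in> pebbling_moves G C" for C u v
    using that sep[of u v] by (fastforce simp: I_def pebbling_moves_def)
  show ?thesis
  proof (rule defender_wins_if_invariant[where I = I])
    show "I C\<^sub>0" using init by (auto simp: I_def)
  next
    show "C r = 0" if "I C" for C using that r by (auto simp: I_def)
  next
    show "apply_move C m r = 0" if "I C" "m \<in> pebbling_moves G C" for C m
      using that r mover[of C "fst m" "snd m"] by (cases m) (auto simp: I_def)
  next
    fix C m
    assume I: "I C" and m: "m \<in> pebbling_moves G C"
      and ne: "legal_moves G (Defender_Turn (apply_move C m) m) \<noteq> {}"
    obtain u v where [simp]: "m = (u, v)" by (cases m)
    define D where "D = apply_move C m"
    from mover[OF I] m have u: "u \<notin> A" "u \<notin> S" and v: "v \<notin> A" by auto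
    \<comment> \<open>Mover pebbled from outside \<open>A\<close> and \<open>S\<close> to
      \<open>v\<close> outside \<open>A\<close>, so \<open>v\<close> is the only vertex where
      \<open>I\<close> can now fail, and by just one pebble.\<close>
    have D_A: "\<forall>w\<in>A. D w = 0" and D_S: "\<forall>w\<in>S. w \<noteq> v \<longrightarrow> D w \<le> 1"
      and D_v: "v \<in> S \<longrightarrow> D v \<le> 2"
      using I u v by (auto simp: D_def I_def)
    \<comment> \<open>The reply must add nothing to \<open>A\<close> or \<open>S\<close>; the last
      disjunct says that it also removes the excess on \<open>v\<close>, if there is one.\<close>
    have "\<exists>x y. x \<rightarrow>\<^bsub>G\<^esub> y \<and> 2 \<le> D x \<and> (x, y) \<noteq> (v, u) \<and> y \<notin> A \<union> S \<and> (x = v \<or> v \<notin> S \<or> D v \<le> 1)"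
    proof (cases "v \<in> S \<and> 2 \<le> D v")
      case True
      then obtain y where "y \<in> nbhd G v - (A \<union> S)" "y \<noteq> u"
        using ex_mem_neq_if_card_ge_2[of "nbhd G v - (A \<union> S)" u] deg_S by blast
      then show ?thesis using True by (auto simp: nbhd_def)
    next
      case False
      from ne obtain x y where xy: "(x, y) \<noteq> (v, u)" "x \<rightarrow>\<^bsub>G\<^esub> y" "2 \<le> D x"
        by (auto simp: pebbling_moves_def D_def)
      have "D x \<noteq> 0" "\<not> D x \<le> 1" using xy(3) by simp_all
      \<comment> \<open>With no excess on \<open>v\<close>, each vertex of \<open>A\<close> or
        \<open>S\<close> holds at most one pebble, so every available move starts outside
        both.\<close>
      then have x: "x \<notin> A \<union> S" using xy(3) D_A D_S False by (metis UnE)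
      have "\<exists>y'. x \<rightarrow>\<^bsub>G\<^esub> y' \<and> y' \<notin> S \<and> (x, y') \<noteq> (v, u)"
      proof (cases "y \<in> S")
        case True
        with x graph_symmetric[OF xy(2)] have "x \<in> nbhd_set G S - (A \<union> S)"
          by (auto simp: nbhd_set_def nbhd_def)
        \<comment> \<open>Avoiding \<open>u\<close> keeps the redirected move legal even when
          \<open>x = v\<close>.\<close>
        then obtain y' where "y' \<in> nbhd G x - S" "y' \<noteq> u"
          using ex_mem_neq_if_card_ge_2[of "nbhd G x - S" u] deg_out by blast
        then show ?thesis by (auto simp: nbhd_def)
      next
        case False
        with xy show ?thesis by blast
      qed
      then obtain y' where "x \<rightarrow>\<^bsub>G\<^esub> y'" "y' \<notin> S" "(x, y') \<noteq> (v, u)" by blast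
      moreover from this x have "y' \<notin> A" using sep by blast
      moreover have "v \<notin> S \<or> D v \<le> 1" using False by linarith
      ultimately show ?thesis using xy(3) by blast
    qed
    then obtain x y where xy: "x \<rightarrow>\<^bsub>G\<^esub> y" "2 \<le> D x" "(x, y) \<noteq> (v, u)" "y \<notin> A \<union> S"
      "x = v \<or> v \<notin> S \<or> D v \<le> 1"
      by blast
    then have "(x, y) \<in> legal_moves G (Defender_Turn D m)"
      by (auto simp: pebbling_moves_def)
    \<comment> \<open>If \<open>x = v\<close> lies in \<open>S\<close>, its at most two pebbles drop
      to zero; otherwise the bounds held already.\<close>
    moreover have "I (apply_move D (x, y))"
      using xy D_A D_S D_v by (auto simp: I_def le_diff_conv)
    ultimately show "\<exists>m'\<in>legal_moves G (Defender_Turn (apply_move C m) m).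
        I (apply_move (apply_move C m) m')"
      unfolding D_def by blast
  qed
qed

text \<open>By symmetry an arc makes its two ends mutually reachable, so they share a component.
  This is the source of the separation property.\<close>

lemma (in sym_digraph) no_arc_leaving_scc:
  assumes "H \<in> sccs" "v \<in> verts H" "u \<rightarrow>\<^bsub>G\<^esub> v"
  shows "u \<in> verts H"
proof -
  have "verts H \<in> sccs_verts" using assms(1) by (rule in_sccs_vertsI_sccs[OF imageI])
  moreover have "v \<rightarrow>\<^sup>* u" "u \<rightarrow>\<^sup>* v" using assms(3) graph_symmetric by blast+
  ultimately show ?thesis using assms(2) unfolding in_sccs_verts_conv_reachable by blast
qed

text \<open>A strong component is nonempty and its vertices reach each other. The contrapositive
  yields a vertex outside the root component.\<close>

lemma (in wf_digraph) strongly_connected_if_spanning_scc: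
  assumes "H \<in> sccs" "verts H = verts G"
  shows "strongly_connected G"
proof -
  have "verts H \<in> sccs_verts" using assms(1) by (rule in_sccs_vertsI_sccs[OF imageI])
  then show ?thesis
    unfolding in_sccs_verts_conv_reachable assms(2) by blast
qed

theorem theorem2p4:
  fixes G :: "('a, 'b) pre_digraph"
    and r :: 'a
    and S :: "'a set"
    and k :: nat
    and Gs :: "nat \<Rightarrow> ('a, 'b) pre_digraph"
  assumes "graph G" and "connected G"
    and "r \<in> verts G"
    and "cut_set G S"
    and "bij_betw Gs {0..k} (components (delete_verts G S))"
    and "r \<in> verts (Gs 0)"
    and "\<forall>v\<in>S. card (nbhd G v - (verts (Gs 0) \<union> S)) \<ge> 2"
    and "\<forall>x \<in> nbhd_set G S - (verts (Gs 0) \<union> S). card (nbhd G x - S) \<ge> 2"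
  shows "eta G r = \<infinity>"
proof -
  interpret graph G by fact
  let ?H = "delete_verts G S"
  have dominates_H: "u \<rightarrow>\<^bsub>?H\<^esub> v \<longleftrightarrow> u \<rightarrow>\<^bsub>G\<^esub> v \<and> u \<notin> S \<and> v \<notin> S" for u v
    by (auto simp: delete_verts_def arcs_ends_conv)
  interpret H: sym_digraph ?H
  proof -
    interpret H: wf_digraph ?H unfolding delete_verts_def by (rule wellformed_induce_subgraph)
    show "sym_digraph ?H"
      by unfold_locales (auto simp: symmetric_def dominates_H intro!: symI dest: graph_symmetric)
  qed
  have scc: "Gs 0 \<in> H.sccs"
    using bij_betwE[OF assms(5)] by (auto simp: components_def)
  then have sub: "verts (Gs 0) \<subseteq> verts ?H"
    by (intro subgraph_imp_subverts induced_imp_subgraph H.in_sccs_imp_induced)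
  \<comment> \<open>\<open>cut_set\<close> speaks of connectedness of the underlying undirected
    graph, which strong connectedness would imply.\<close>
  have "\<not> strongly_connected ?H"
    using assms(4) H.connectedI H.reachable_mk_symmetricI
    unfolding cut_set_def strongly_connected_def by blast
  with H.strongly_connected_if_spanning_scc[OF scc] sub
  obtain b where b: "b \<in> verts G" "b \<notin> verts (Gs 0) \<union> S"
    by (auto simp: delete_verts_def)
  have sep: "v \<notin> verts (Gs 0)" if "u \<rightarrow>\<^bsub>G\<^esub> v" "u \<notin> verts (Gs 0) \<union> S" for u v
  proof
    assume v: "v \<in> verts (Gs 0)"
    then have "v \<notin> S" using sub by (auto simp: delete_verts_def)
    then have "u \<rightarrow>\<^bsub>?H\<^esub> v" using that dominates_H by blast
    then show False using H.no_arc_leaving_scc[OF scc v] that(2) by blast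
  qed
  have "\<exists>C. configuration G C \<and> m < config_size G C \<and> has_winning_strategy G r C Defender" for m
  proof (intro exI conjI)
    \<comment> \<open>Piling all pebbles on the single vertex \<open>b\<close> gives starting
      configurations of any positive size.\<close>
    let ?C = "\<lambda>v. if v = b then Suc m else 0"
    show "configuration G ?C" using b by (auto simp: configuration_def)
    show "m < config_size G ?C" using b by (simp add: config_size_def)
    show "has_winning_strategy G r ?C Defender"
    proof (rule defender_wins_if_outside_root_side[OF assms(1,6) _ assms(7,8)])
      show "v \<notin> verts (Gs 0)" if "u \<rightarrow>\<^bsub>G\<^esub> v" "u \<notin> verts (Gs 0) \<union> S" for u v
        using that by (rule sep)
    qed (use b in auto)
  qed
  then show ?thesis by (simp add: eta_def)
qed

end
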